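(* Let $n\ge2$, and fix $\ell\in\{3,\ldots,n-2\}$. Let $p(x)=x^n+c_{n-1}x^{n-1}+\cdots+c_1x+c_0$ be a polynomial over $\mathbb{R}$ with $c_0=1$ and $$(c_\ell c_{n-1})^2<2c_{\ell-1}c_\ell c_{n-1}-1.$$ Let $M=M_n(c_\ell,\ell)$ be the matrix constructed from $p(x)$ with parameter $a=c_\ell$. Then $\kappa(M)<\kappa(F)$ for every Fiedler companion matrix $F$ of $p(x)$.
   Context: For a real $n\times n$ matrix $A=[a_{i,j}]$, $\|A\|=\sqrt{\sum_{i,j}a_{i,j}^2}$ is the Frobenius norm, and for invertible $A$, $\kappa(A)=\|A\|\cdot\|A^{-1}\|$. Two matrices are called equivalent if one is obtained from the other by transposition and/or permutation similarity. Given $p(x)=x^n+c_{n-1}x^{n-1}+\cdots+c_0$, $a\in\mathbb{R}$ and $\ell\in\{3,\ldots,n-2\}$, the $n\times n$ matrix $M_n(a,\ell)$ is defined as follows: it has $1$ in each position $(i,i+1)$, $1\le i\le n-1$; its first column has entry $-c_{n-i}$ in row $i$, except that row $n-\ell$ has $-c_\ell+a$ and row $n-\ell+1$ has $-c_{\ell-1}+ac_{n-1}$; the entry in position $(n-\ell+1,2)$ is $-a$; all other entries are $0$. Fiedler companion matrices: let $F_0=\mathrm{diag}(1,\ldots,1,-c_0)$ and, for $1\le k\le n-1$, let $F_k$ be the block diagonal matrix with diagonal blocks $I_{n-k-1}$, $\begin{bmatrix}-c_k&1\\1&0\end{bmatrix}$, $I_{k-1}$ (in this order). A Fiedler companion matrix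 to $p(x)$ is a matrix equal (or equivalent) to a product $F_{\sigma_0}F_{\sigma_1}\cdots F_{\sigma_{n-1}}$ for some permutation $(\sigma_0,\ldots,\sigma_{n-1})$ of $\{0,1,\ldots,n-1\}$. *)

theory Defs
  imports
    "Jordan_Normal_Form.Gauss_Jordan_Elimination"
    "Jordan_Normal_Form.Determinant"
    "HOL-Computational_Algebra.Polynomial"
    "HOL-Combinatorics.Permutations"
begin

text \<open>
  Matrices and permutations are 0-based, so the entry in position \<open>(i, j)\<close> in
  the usual 1-based convention is \<open>A $$ (i - 1, j - 1)\<close>. The coefficient
  \<open>c\<^sub>i\<close> of the polynomial is \<open>coeff p i\<close>.
\<close>

definition frobenius_norm :: "real mat \<Rightarrow> real" where
  "frobenius_norm A = sqrt (\<Sum>i<dim_row A. \<Sum>j<dim_col A. (A $$ (i, j))\<^sup>2)"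

text \<open>
  Meaningful only for invertible \<open>A\<close>: otherwise \<open>mat_inverse A = None\<close> and
  the value is unspecified.
\<close>
definition cond_number :: "real mat \<Rightarrow> real" where
  "cond_number A = frobenius_norm A * frobenius_norm (the (mat_inverse A))"

lemma mat_inverse_unique:
  fixes A B :: "real mat"
  assumes A: "A \<in> carrier_mat n n" and B: "B \<in> carrier_mat n n" and AB: "A * B = 1\<^sub>m n"
  shows "mat_inverse A = Some B"
proof -
  have BA: "B * A = 1\<^sub>m n"
    using mat_mult_left_right_inverse[OF A B AB] .
  have "A \<in> Units (ring_mat TYPE(real) n ())"
    using A B AB BA by (auto simp: Units_def ring_mat_def)
  then obtain C where C: "mat_inverse A = Some C"
    using mat_inverse(1)[OF A, where b = "()"] by (cases "mat_inverse A") auto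
  from mat_inverse(2)[OF A C] have AC: "A * C = 1\<^sub>m n" and Cc: "C \<in> carrier_mat n n" by auto
  have "C = (B * A) * C" using BA Cc by simp
  also have "\<dots> = B" using assoc_mult_mat[OF B A Cc] AC B by simp
  finally show ?thesis using C by simp
qed

definition perm_matrix :: "nat \<Rightarrow> (nat \<Rightarrow> nat) \<Rightarrow> real mat" where
  "perm_matrix n \<pi> = mat n n (\<lambda>(i, j). if j = \<pi> i then 1 else 0)"

definition equivalent_mat :: "nat \<Rightarrow> real mat \<Rightarrow> real mat \<Rightarrow> bool" where
  "equivalent_mat n A B \<longleftrightarrow>
     (\<exists>\<pi>. \<pi> permutes {..<n} \<and>
        (let P = perm_matrix n \<pi> in
           B = P * A * transpose_mat P \<or> B = P * transpose_mat A * transpose_mat P))"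

text \<open>
  The branches are disjoint for \<open>3 \<le> l \<le> n - 2\<close>, so their order is immaterial.
\<close>
definition M_mat :: "nat \<Rightarrow> real poly \<Rightarrow> real \<Rightarrow> nat \<Rightarrow> real mat" where
  "M_mat n p a l = mat n n (\<lambda>(i', j'). let i = i' + 1; j = j' + 1 in
     if j = i + 1 then 1
     else if j = 1 then
       (if i = n - l then - coeff p l + a
        else if i = n - l + 1 then - coeff p (l - 1) + a * coeff p (n - 1)
        else - coeff p (n - i))
     else if i = n - l + 1 \<and> j = 2 then - a
     else 0)"

definition fiedler_factor :: "nat \<Rightarrow> real poly \<Rightarrow> nat \<Rightarrow> real mat" where
  "fiedler_factor n p k =
     (if k = 0 then mat_diag n (\<lambda>i. if i = n - 1 then - coeff p 0 else 1)
      else diag_block_mat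
        [1\<^sub>m (n - k - 1),
         mat_of_rows_list 2 [[- coeff p k, 1], [1, 0]],
         1\<^sub>m (k - 1)])"

definition fiedler_product :: "nat \<Rightarrow> real poly \<Rightarrow> (nat \<Rightarrow> nat) \<Rightarrow> real mat" where
  "fiedler_product n p \<sigma> = foldr (\<lambda>i A. fiedler_factor n p (\<sigma> i) * A) [0..<n] (1\<^sub>m n)"

definition fiedler_companion :: "nat \<Rightarrow> real poly \<Rightarrow> real mat \<Rightarrow> bool" where
  "fiedler_companion n p F \<longleftrightarrow>
     (\<exists>\<sigma>. \<sigma> permutes {..<n} \<and>
        (F = fiedler_product n p \<sigma> \<or> equivalent_mat n (fiedler_product n p \<sigma>) F))"

end

theory Submission
  imports Defs
begin

text \<open>
  Write \<open>S\<close> for the sum of the squares \<open>c\<^sub>k\<^sup>2\<close>, \<open>k < n\<close>. In a product of Fiedler factors the factor of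
  largest index commutes with all others except its predecessor, so it can be moved to the left
  or the right end. There it only mixes one trivial row (or column) with one further row, which
  raises the squared Frobenius norm by exactly \<open>c\<^sub>k\<^sup>2\<close>; for the inverse product the raise is \<open>c\<^sub>k\<^sup>2\<close>
  times the squared norm of that further row, which stays \<open>1\<close> since \<open>c\<^sub>0\<^sup>2 = 1\<close>. Hence every
  Fiedler matrix has \<open>\<kappa>(F) = n - 1 + S\<close>. The inverse of \<open>M\<close> is explicit and has the same norm
  as \<open>F\<close>, while \<open>\<parallel>M\<parallel>\<^sup>2 = \<parallel>F\<parallel>\<^sup>2 + (c\<^sub>l c\<^sub>n\<^sub>-\<^sub>1)\<^sup>2 - 2 c\<^sub>l\<^sub>-\<^sub>1 c\<^sub>l c\<^sub>n\<^sub>-\<^sub>1 < \<parallel>F\<parallel>\<^sup>2\<close>.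
\<close>

subsection \<open>Frobenius norms\<close>

definition row_sq :: "real mat \<Rightarrow> nat \<Rightarrow> real" where
  "row_sq A i = (\<Sum>k<dim_col A. (A $$ (i, k))\<^sup>2)"

lemma frobenius_norm_sq: "(frobenius_norm A)\<^sup>2 = (\<Sum>i<dim_row A. row_sq A i)"
  unfolding frobenius_norm_def row_sq_def by (simp add: sum_nonneg)

lemma frobenius_norm_nonneg: "0 \<le> frobenius_norm A"
  unfolding frobenius_norm_def by (simp add: sum_nonneg)

lemma frobenius_norm_transpose: "frobenius_norm (transpose_mat A) = frobenius_norm A"
  unfolding frobenius_norm_def
  by (simp, rule sum.swap[THEN trans]) simp

text \<open>A one-sided inverse of a square matrix is its inverse, so an explicit witness
  \<open>B\<close> can stand in for the option-valued \<open>mat_inverse\<close>.\<close>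

lemma cond_number_eq:
  assumes "A \<in> carrier_mat n n" "B \<in> carrier_mat n n" "A * B = 1\<^sub>m n"
  shows "cond_number A = frobenius_norm A * frobenius_norm B"
  unfolding cond_number_def using mat_inverse_unique[OF assms] by simp

subsection \<open>Equivalence preserves the condition number\<close>

text \<open>Permutation similarity as a reindexing of entries, which turns norms and products into
  permuted sums.\<close>

definition permute_mat :: "nat \<Rightarrow> (nat \<Rightarrow> nat) \<Rightarrow> real mat \<Rightarrow> real mat" where
  "permute_mat n \<pi> A = mat n n (\<lambda>(i, j). A $$ (\<pi> i, \<pi> j))"

lemma permute_mat_carrier [simp]: "permute_mat n \<pi> A \<in> carrier_mat n n"
  by (simp add: permute_mat_def)

lemma perm_matrix_conj:
  assumes \<pi>: "\<pi> permutes {..<n}" and A: "A \<in> carrier_mat n n"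
  shows "perm_matrix n \<pi> * A * transpose_mat (perm_matrix n \<pi>) = permute_mat n \<pi> A"
proof -
  have lt: "\<pi> i < n" if "i < n" for i
    using permutes_in_image[OF \<pi>, of i] that by simp
  have PA: "perm_matrix n \<pi> * A = mat n n (\<lambda>(i, j). A $$ (\<pi> i, j))"
    using A lt by (intro eq_matI)
      (auto simp: perm_matrix_def scalar_prod_def if_distrib[of "\<lambda>x. x * _"] cong: if_cong)
  show ?thesis
    unfolding PA using lt by (intro eq_matI)
      (auto simp: perm_matrix_def permute_mat_def scalar_prod_def if_distrib[of "\<lambda>x. _ * x"] cong: if_cong)
qed

lemma sum_permutes_lessThan:
  fixes f :: "nat \<Rightarrow> real"
  assumes "\<pi> permutes {..<n}"
  shows "(\<Sum>i<n. f (\<pi> i)) = (\<Sum>i<n. f i)"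
  using sum.permute[OF assms, of f] by (simp add: o_def)

lemma frobenius_norm_permute_mat:
  assumes \<pi>: "\<pi> permutes {..<n}" and A: "A \<in> carrier_mat n n"
  shows "frobenius_norm (permute_mat n \<pi> A) = frobenius_norm A"
proof -
  have "(\<Sum>i<n. \<Sum>j<n. (A $$ (\<pi> i, \<pi> j))\<^sup>2) = (\<Sum>i<n. \<Sum>j<n. (A $$ (\<pi> i, j))\<^sup>2)"
    by (intro sum.cong refl sum_permutes_lessThan[OF \<pi>])
  also have "\<dots> = (\<Sum>i<n. \<Sum>j<n. (A $$ (i, j))\<^sup>2)"
    by (rule sum_permutes_lessThan[OF \<pi>])
  finally show ?thesis
    using A by (simp add: frobenius_norm_def permute_mat_def)
qed

lemma mult_mat_entry:
  fixes A B :: "real mat"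
  assumes "A \<in> carrier_mat n n" "B \<in> carrier_mat n n" "i < n" "j < n"
  shows "(A * B) $$ (i, j) = (\<Sum>k<n. A $$ (i, k) * B $$ (k, j))"
  using assms by (simp add: scalar_prod_def lessThan_atLeast0)

lemma permute_mat_mult_one:
  assumes \<pi>: "\<pi> permutes {..<n}" and A: "A \<in> carrier_mat n n" and B: "B \<in> carrier_mat n n"
    and AB: "A * B = 1\<^sub>m n"
  shows "permute_mat n \<pi> A * permute_mat n \<pi> B = 1\<^sub>m n"
proof (rule eq_matI)
  fix i j assume "i < dim_row (1\<^sub>m n :: real mat)" "j < dim_col (1\<^sub>m n :: real mat)"
  then have ij: "i < n" "j < n" by auto
  then have p: "\<pi> i < n" "\<pi> j < n"
    using permutes_in_image[OF \<pi>] by auto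
  have "(permute_mat n \<pi> A * permute_mat n \<pi> B) $$ (i, j)
      = (\<Sum>k<n. A $$ (\<pi> i, \<pi> k) * B $$ (\<pi> k, \<pi> j))"
    using ij by (subst mult_mat_entry[where n = n]) (auto simp: permute_mat_def)
  also have "\<dots> = (\<Sum>k<n. A $$ (\<pi> i, k) * B $$ (k, \<pi> j))"
    by (rule sum_permutes_lessThan[OF \<pi>])
  also have "\<dots> = (A * B) $$ (\<pi> i, \<pi> j)"
    using mult_mat_entry[OF A B p] by simp
  also have "\<dots> = 1\<^sub>m n $$ (i, j)"
    using AB ij p permutes_inj[OF \<pi>] by (simp add: inj_eq)
  finally show "(permute_mat n \<pi> A * permute_mat n \<pi> B) $$ (i, j) = 1\<^sub>m n $$ (i, j)" .
qed (simp_all add: permute_mat_def)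

text \<open>Transposing and reindexing \<open>B\<close> along with \<open>A\<close> keeps the two
  matrices mutually inverse and leaves both norms unchanged.\<close>

lemma cond_number_equivalent_mat:
  assumes A: "A \<in> carrier_mat n n" and B: "B \<in> carrier_mat n n" and AB: "A * B = 1\<^sub>m n"
    and eqv: "equivalent_mat n A F"
  shows "cond_number F = cond_number A"
proof -
  obtain \<pi> where \<pi>: "\<pi> permutes {..<n}"
    and F: "F = permute_mat n \<pi> A \<or> F = permute_mat n \<pi> (transpose_mat A)"
    using eqv perm_matrix_conj A unfolding equivalent_mat_def Let_def
    by (metis transpose_carrier_mat)
  \<comment> \<open>Transposition reverses products, so the inverse of the transpose comes from this
    other identity.\<close>
  have BA: "B * A = 1\<^sub>m n"
    using mat_mult_left_right_inverse[OF A B AB] .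
  have T: "transpose_mat A * transpose_mat B = 1\<^sub>m n"
    using transpose_mult[OF B A] BA by simp
  show ?thesis
    using F
  proof
    assume "F = permute_mat n \<pi> A"
    then show ?thesis
      using cond_number_eq[OF _ _ permute_mat_mult_one[OF \<pi> A B AB]] cond_number_eq[OF A B AB]
      by (simp add: frobenius_norm_permute_mat[OF \<pi>] A B)
  next
    assume "F = permute_mat n \<pi> (transpose_mat A)"
    then show ?thesis
      using cond_number_eq[OF _ _ permute_mat_mult_one[OF \<pi> _ _ T]] cond_number_eq[OF A B AB]
      by (simp add: frobenius_norm_permute_mat[OF \<pi>] frobenius_norm_transpose A B)
  qed
qed

subsection \<open>Products of a family of matrices in an arbitrary order\<close>

text \<open>Indexing by a list of labels instead of a permutation makes reordering a matter of
  splitting lists, and gives access to products over \<open>{..m}\<close> for induction on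
  \<open>m\<close>.\<close>

definition mat_prod :: "nat \<Rightarrow> (nat \<Rightarrow> real mat) \<Rightarrow> nat list \<Rightarrow> real mat" where
  "mat_prod n X L = foldr (\<lambda>k A. X k * A) L (1\<^sub>m n)"

lemma mat_prod_Nil [simp]: "mat_prod n X [] = 1\<^sub>m n"
  and mat_prod_Cons [simp]: "mat_prod n X (k # L) = X k * mat_prod n X L"
  by (simp_all add: mat_prod_def)

lemma mat_prod_carrier:
  "(\<And>k. k \<in> set L \<Longrightarrow> X k \<in> carrier_mat n n) \<Longrightarrow> mat_prod n X L \<in> carrier_mat n n"
  by (induction L) (auto intro!: mult_carrier_mat)

lemma mat_prod_append:
  assumes "\<And>k. k \<in> set K \<Longrightarrow> X k \<in> carrier_mat n n" "\<And>k. k \<in> set L \<Longrightarrow> X k \<in> carrier_mat n n"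
  shows "mat_prod n X (K @ L) = mat_prod n X K * mat_prod n X L"
  using assms
proof (induction K)
  case Nil
  then show ?case using mat_prod_carrier[of L X n] by simp
next
  case (Cons k K)
  then show ?case
    using assoc_mult_mat[of "X k" n n "mat_prod n X K" n "mat_prod n X L" n]
      mat_prod_carrier[of L X n] mat_prod_carrier[of K X n] by simp
qed

lemma mat_prod_commute:
  assumes "A \<in> carrier_mat n n" "\<And>k. k \<in> set L \<Longrightarrow> X k \<in> carrier_mat n n"
    and "\<And>k. k \<in> set L \<Longrightarrow> A * X k = X k * A"
  shows "A * mat_prod n X L = mat_prod n X L * A"
  using assms
proof (induction L)
  case (Cons k L)
  let ?P = "mat_prod n X L"
  have c: "X k \<in> carrier_mat n n" "?P \<in> carrier_mat n n"
    using Cons.prems by (auto intro: mat_prod_carrier)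
  have "A * (X k * ?P) = X k * A * ?P"
    using assoc_mult_mat[OF Cons.prems(1) c] Cons.prems(3)[of k] by simp
  also have "\<dots> = X k * (?P * A)"
    using assoc_mult_mat[OF c(1) Cons.prems(1) c(2)] Cons by simp
  finally show ?case
    using assoc_mult_mat[OF c Cons.prems(1)] by simp
qed simp

text \<open>In reversed order the factors cancel in pairs from the middle outwards.\<close>

lemma mat_prod_inverse:
  assumes "\<And>k. k \<in> set L \<Longrightarrow> X k \<in> carrier_mat n n" "\<And>k. k \<in> set L \<Longrightarrow> Y k \<in> carrier_mat n n"
    and "\<And>k. k \<in> set L \<Longrightarrow> X k * Y k = 1\<^sub>m n"
  shows "mat_prod n X L * mat_prod n Y (rev L) = 1\<^sub>m n"
  using assms
proof (induction L)
  case (Cons k L)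
  let ?P = "mat_prod n X L" and ?Q = "mat_prod n Y (rev L)"
  have c: "X k \<in> carrier_mat n n" "Y k \<in> carrier_mat n n"
    "?P \<in> carrier_mat n n" "?Q \<in> carrier_mat n n"
    using Cons.prems by (auto intro!: mat_prod_carrier)
  have Q: "mat_prod n Y (rev (k # L)) = ?Q * Y k"
    using mat_prod_append[of "rev L" Y n "[k]"] Cons.prems(2) c by auto
  have "X k * ?P * (?Q * Y k) = X k * (?P * ?Q * Y k)"
    using assoc_mult_mat[OF c(1,3) mult_carrier_mat[OF c(4,2)]] assoc_mult_mat[OF c(3,4,2)] by simp
  also have "\<dots> = X k * Y k"
    using Cons left_mult_one_mat[OF c(2)] by simp
  also have "\<dots> = 1\<^sub>m n"
    using Cons.prems by simp
  finally show ?case unfolding Q by simp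
qed simp

text \<open>The last factor commutes with every factor of index below \<open>m\<close>. Distinctness
  leaves \<open>m\<close> on at most one side of it, so it can leave through the other side.\<close>

lemma mat_prod_move_last:
  assumes L: "distinct L" "set L = {..Suc m}"
    and X: "\<And>k. k \<le> Suc m \<Longrightarrow> X k \<in> carrier_mat n n"
    and comm: "\<And>k. k < m \<Longrightarrow> X (Suc m) * X k = X k * X (Suc m)"
  obtains K where "distinct K" "set K = {..m}"
    "mat_prod n X L = X (Suc m) * mat_prod n X K \<or> mat_prod n X L = mat_prod n X K * X (Suc m)"
proof -
  obtain A B where AB: "L = A @ Suc m # B"
    using L(2) split_list[of "Suc m" L] by auto
  have K: "distinct (A @ B)" "set (A @ B) = {..m}"
    using L AB by (auto simp: set_eq_iff le_Suc_eq)
      (metis L(2) Un_iff atMost_iff le_Suc_eq set_append Suc_n_not_le_n)+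
  have lt: "k \<le> m" if "k \<in> set A \<or> k \<in> set B" for k
    using K(2) that by auto
  let ?X = "X (Suc m)" and ?A = "mat_prod n X A" and ?B = "mat_prod n X B"
  have c: "?X \<in> carrier_mat n n" "?A \<in> carrier_mat n n" "?B \<in> carrier_mat n n"
    using X lt by (auto intro!: mat_prod_carrier simp: le_SucI)
  have PL: "mat_prod n X L = ?A * (?X * ?B)"
    unfolding AB mat_prod_Cons[symmetric]
    by (rule mat_prod_append) (use X lt in \<open>auto simp: le_SucI\<close>)
  have PK: "mat_prod n X (A @ B) = ?A * ?B"
    by (rule mat_prod_append) (use X lt in \<open>auto simp: le_SucI\<close>)
  have "m \<notin> set A \<or> m \<notin> set B"
    using K(1) by auto
  then have "mat_prod n X L = ?X * mat_prod n X (A @ B) \<or> mat_prod n X L = mat_prod n X (A @ B) * ?X"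
  proof
    assume "m \<notin> set A"
    then have "k < m" if "k \<in> set A" for k
      using lt[of k] that by (cases "k = m") auto
    then have "?X * ?A = ?A * ?X"
      using lt X c(1) comm by (intro mat_prod_commute) (auto simp: le_SucI)
    then show ?thesis
      unfolding PL PK using assoc_mult_mat[OF c(2,1,3)] assoc_mult_mat[OF c(1,2,3)] by simp
  next
    assume "m \<notin> set B"
    then have "k < m" if "k \<in> set B" for k
      using lt[of k] that by (cases "k = m") auto
    then have "?X * ?B = ?B * ?X"
      using lt X c(1) comm by (intro mat_prod_commute) (auto simp: le_SucI)
    then show ?thesis
      unfolding PL PK using assoc_mult_mat[OF c(2,3,1)] by simp
  qed
  with K that show thesis by blast
qed

subsection \<open>Fiedler factors and their inverses\<close>

text \<open>One shape for two families: \<open>v = 0\<close> gives the Fiedler factors of positive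
  index and \<open>u = 0\<close> their inverses, so a single norm computation serves both.\<close>

definition block_factor :: "nat \<Rightarrow> nat \<Rightarrow> real \<Rightarrow> real \<Rightarrow> real mat" where
  "block_factor n j u v = mat n n (\<lambda>(i, k).
     if i = j then (if k = j then u else if k = Suc j then 1 else 0)
     else if i = Suc j then (if k = j then 1 else if k = Suc j then v else 0)
     else if i = k then 1 else 0)"

definition end_factor :: "nat \<Rightarrow> real \<Rightarrow> real mat" where
  "end_factor n d = mat_diag n (\<lambda>i. if i = n - 1 then d else 1)"

lemma block_factor_carrier [simp]: "block_factor n j u v \<in> carrier_mat n n"
  and end_factor_carrier [simp]: "end_factor n d \<in> carrier_mat n n"
  by (simp_all add: block_factor_def end_factor_def)

lemma block_factor_transpose [simp]: "transpose_mat (block_factor n j u v) = block_factor n j u v"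
  by (intro eq_matI) (auto simp: block_factor_def)

lemma block_factor_mult_entry:
  assumes A: "A \<in> carrier_mat n n" and "Suc j < n" "i < n" "k < n"
  shows "(block_factor n j u v * A) $$ (i, k) =
    (if i = j then u * A $$ (j, k) + A $$ (Suc j, k)
     else if i = Suc j then A $$ (j, k) + v * A $$ (Suc j, k)
     else A $$ (i, k))"
proof -
  have "(block_factor n j u v * A) $$ (i, k) = (\<Sum>r<n. block_factor n j u v $$ (i, r) * A $$ (r, k))"
    by (rule mult_mat_entry) (use assms in auto)
  \<comment> \<open>Each row of the factor is split into single-index indicator terms, so that every
    sum over \<open>r\<close> collapses.\<close>
  also have "\<dots> = (\<Sum>r<n. (if r = i \<and> i \<noteq> j \<and> i \<noteq> Suc j then A $$ (r, k) else 0)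
      + (if r = j then (if i = j then u else if i = Suc j then 1 else 0) * A $$ (r, k) else 0)
      + (if r = Suc j then (if i = j then 1 else if i = Suc j then v else 0) * A $$ (r, k) else 0))"
    using assms by (intro sum.cong) (auto simp: block_factor_def)
  finally show ?thesis
    using assms by (cases "i = j \<or> i = Suc j") (auto simp: sum.distrib)
qed

lemma end_factor_mult_entry:
  assumes "A \<in> carrier_mat n n" "i < n" "k < n"
  shows "(end_factor n d * A) $$ (i, k) = (if i = n - 1 then d else 1) * A $$ (i, k)"
  using assms by (simp add: end_factor_def mat_diag_mult_left)

text \<open>The two blocks occupy disjoint pairs of rows and columns.\<close>

lemma block_factor_commute:
  assumes "Suc j < i" "Suc i < n"
  shows "block_factor n j u v * block_factor n i u' v' = block_factor n i u' v' * block_factor n j u v"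
proof (rule eq_matI)
  fix r s
  assume "r < dim_row (block_factor n i u' v' * block_factor n j u v)"
    "s < dim_col (block_factor n i u' v' * block_factor n j u v)"
  then have rs: "r < n" "s < n" by (auto simp: block_factor_def)
  show "(block_factor n j u v * block_factor n i u' v') $$ (r, s)
      = (block_factor n i u' v' * block_factor n j u v) $$ (r, s)"
    using assms rs
    by (simp only: block_factor_mult_entry block_factor_carrier Suc_lessD) (auto simp: block_factor_def)
qed (auto simp: block_factor_def)

lemma block_end_factor_commute:
  assumes "Suc (Suc j) < n"
  shows "block_factor n j u v * end_factor n d = end_factor n d * block_factor n j u v"
proof (rule eq_matI)
  fix r s
  assume "r < dim_row (end_factor n d * block_factor n j u v)"
    "s < dim_col (end_factor n d * block_factor n j u v)"
  then have rs: "r < n" "s < n" by (auto simp: block_factor_def end_factor_def mat_diag_def)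
  show "(block_factor n j u v * end_factor n d) $$ (r, s) = (end_factor n d * block_factor n j u v) $$ (r, s)"
    using assms rs
    by (simp add: block_factor_mult_entry end_factor_mult_entry)
      (auto simp: block_factor_def end_factor_def mat_diag_def)
qed (auto simp: block_factor_def end_factor_def mat_diag_def)

lemma block_factor_inverse:
  assumes "Suc j < n"
  shows "block_factor n j u 0 * block_factor n j 0 (- u) = 1\<^sub>m n"
proof (rule eq_matI)
  fix r s assume "r < dim_row (1\<^sub>m n :: real mat)" "s < dim_col (1\<^sub>m n :: real mat)"
  then show "(block_factor n j u 0 * block_factor n j 0 (- u)) $$ (r, s) = 1\<^sub>m n $$ (r, s)"
    using assms by (simp add: block_factor_mult_entry) (auto simp: block_factor_def)
qed (auto simp: block_factor_def)

lemma fiedler_factor_0: "fiedler_factor n p 0 = end_factor n (- coeff p 0)"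
  by (simp add: fiedler_factor_def end_factor_def)

text \<open>The size is written \<open>q + 2 + r\<close> to avoid truncated subtraction; the
  recursive block sum is evaluated from its last blocks upwards.\<close>

lemma diag_block_mat_eq_block_factor:
  "diag_block_mat [1\<^sub>m q, mat_of_rows_list 2 [[u, 1], [1, 0]], 1\<^sub>m r] = block_factor (q + 2 + r) q u 0"
proof -
  let ?B = "mat 2 2 (\<lambda>(i, j). if i = 0 \<and> j = 0 then u else if i = 1 \<and> j = 1 then 0 else 1)"
  have B: "mat_of_rows_list 2 [[u, 1], [1, 0]] = ?B"
    by (intro eq_matI) (auto simp: mat_of_rows_list_def less_2_cases_iff)
  have C: "diag_block_mat [?B, 1\<^sub>m r] = mat (2 + r) (2 + r) (\<lambda>(i, j).
      if i = 0 \<and> j = 0 then u else if i = 1 \<and> j = 1 then 0 else if i < 2 \<and> j < 2 \<or> i = j then 1 else 0)"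
    by (intro eq_matI) (auto simp: Let_def)
  have D: "diag_block_mat [1\<^sub>m q, ?B, 1\<^sub>m r]
      = four_block_mat (1\<^sub>m q) (0\<^sub>m q (2 + r)) (0\<^sub>m (2 + r) q) (diag_block_mat [?B, 1\<^sub>m r])"
    unfolding C by (simp add: C[simplified] Let_def)
  show ?thesis
    unfolding B D C by (intro eq_matI) (auto simp: block_factor_def)
qed

text \<open>The larger \<open>k\<close>, the higher the block sits. Adding factors by increasing
  index therefore extends the nontrivial part of a product upwards from the bottom right
  corner.\<close>

lemma fiedler_factor_eq_block_factor:
  assumes "0 < k" "k < n"
  shows "fiedler_factor n p k = block_factor n (n - k - 1) (- coeff p k) 0"
proof -
  have "n - k - 1 + 2 + (k - 1) = n"
    using assms by simp
  then show ?thesis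
    using assms diag_block_mat_eq_block_factor[of "n - k - 1" "- coeff p k" "k - 1"]
    by (simp add: fiedler_factor_def)
qed

subsection \<open>Frobenius norms of products of factors\<close>

text \<open>For an \<open>n\<close> by \<open>n\<close> matrix and \<open>q \<le> n\<close>: a
  direct sum of the identity of size \<open>q\<close> and one further block.\<close>

definition trivial_upto :: "nat \<Rightarrow> nat \<Rightarrow> real mat \<Rightarrow> bool" where
  "trivial_upto n q A \<longleftrightarrow>
     (\<forall>i<q. \<forall>k<n. A $$ (i, k) = of_bool (i = k) \<and> A $$ (k, i) = of_bool (i = k))"

lemma trivial_upto_transpose:
  assumes "A \<in> carrier_mat n n" "q \<le> n"
  shows "trivial_upto n q (transpose_mat A) \<longleftrightarrow> trivial_upto n q A"
proof -
  have "transpose_mat A $$ (i, k) = A $$ (k, i)" "transpose_mat A $$ (k, i) = A $$ (i, k)"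
    if "i < q" "k < n" for i k
    using that assms by auto
  then show ?thesis
    unfolding trivial_upto_def by (metis (no_types, lifting))
qed

text \<open>Row \<open>j\<close> of \<open>A\<close> is the unit vector \<open>e_j\<close>, and row
  \<open>r = Suc j\<close> of \<open>A\<close> vanishes in column \<open>j\<close>. The new rows
  \<open>u * e_j + A_r\<close> and \<open>e_j + v * A_r\<close> are thus sums of orthogonal vectors,
  and column \<open>j\<close> retains only the entries \<open>u\<close> and
  \<open>1\<close>.\<close>

lemma block_factor_mult_step:
  fixes u v :: real
  assumes A: "A \<in> carrier_mat n n" and j: "Suc j < n" and triv: "trivial_upto n (Suc j) A"
  defines "C \<equiv> block_factor n j u v * A"
  shows "(frobenius_norm C)\<^sup>2 = (frobenius_norm A)\<^sup>2 + u\<^sup>2 + v\<^sup>2 * row_sq A (Suc j)"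
    and "row_sq C j = u\<^sup>2 + row_sq A (Suc j)"
    and "row_sq (transpose_mat C) j = u\<^sup>2 + 1"
    and "trivial_upto n j C"
proof -
  have C: "C \<in> carrier_mat n n"
    using A unfolding C_def by (meson block_factor_carrier mult_carrier_mat)
  have e: "C $$ (i, k) =
    (if i = j then u * A $$ (j, k) + A $$ (Suc j, k)
     else if i = Suc j then A $$ (j, k) + v * A $$ (Suc j, k)
     else A $$ (i, k))" if "i < n" "k < n" for i k
    unfolding C_def by (rule block_factor_mult_entry[OF A j that])
  have t: "A $$ (i, k) = of_bool (i = k)" "A $$ (k, i) = of_bool (i = k)" if "i \<le> j" "k < n" for i k
    using triv that unfolding trivial_upto_def by auto
  have "row_sq C j = (\<Sum>k<n. (if k = j then u\<^sup>2 else 0) + (A $$ (Suc j, k))\<^sup>2)"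
    using C j by (auto simp: row_sq_def e t intro!: sum.cong)
  then show row: "row_sq C j = u\<^sup>2 + row_sq A (Suc j)"
    using A j by (simp add: sum.distrib row_sq_def)
  have "row_sq C (Suc j) = (\<Sum>k<n. (if k = j then 1 else 0) + v\<^sup>2 * (A $$ (Suc j, k))\<^sup>2)"
    using C j by (auto simp: row_sq_def e t power_mult_distrib intro!: sum.cong)
  then have row': "row_sq C (Suc j) = 1 + v\<^sup>2 * row_sq A (Suc j)"
    using A j by (simp add: sum.distrib row_sq_def sum_distrib_left)
  have rowA: "row_sq A j = 1"
    using A j by (simp add: row_sq_def t if_distrib[of "\<lambda>x. x\<^sup>2"] of_bool_def cong: if_cong)
  have other: "row_sq C i = row_sq A i" if "i < n" "i \<noteq> j" "i \<noteq> Suc j" for i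
    using that A C by (auto simp: row_sq_def e)
  have split: "(\<Sum>i<n. f i) = f j + f (Suc j) + (\<Sum>i\<in>{..<n} - {j, Suc j}. f i)" for f :: "nat \<Rightarrow> real"
    using j sum.subset_diff[of "{j, Suc j}" "{..<n}" f] by simp
  have "(\<Sum>i\<in>{..<n} - {j, Suc j}. row_sq C i) = (\<Sum>i\<in>{..<n} - {j, Suc j}. row_sq A i)"
    by (intro sum.cong) (auto simp: other)
  then show "(frobenius_norm C)\<^sup>2 = (frobenius_norm A)\<^sup>2 + u\<^sup>2 + v\<^sup>2 * row_sq A (Suc j)"
    unfolding frobenius_norm_sq using A C split[of "row_sq A"] split[of "row_sq C"]
    by (simp add: row row' rowA)
  have "row_sq (transpose_mat C) j = (\<Sum>k<n. (if k = j then u\<^sup>2 else 0) + (if k = Suc j then 1 else 0))"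
    using C j by (auto simp: row_sq_def e t intro!: sum.cong)
  then show "row_sq (transpose_mat C) j = u\<^sup>2 + 1"
    using j by (simp add: sum.distrib)
  show "trivial_upto n j C"
    unfolding trivial_upto_def using j by (auto simp: e t)
qed

text \<open>
  The corner row and column stay normalised only when all \<open>u k\<close> vanish, and they matter only
  when some \<open>v k\<close> does not: hence the disjunctive hypothesis.
\<close>
lemma factor_product_norm:
  fixes u v :: "nat \<Rightarrow> real"
  assumes X0: "X 0 = end_factor n d"
    and XS: "\<And>k. Suc k < n \<Longrightarrow> X (Suc k) = block_factor n (n - k - 2) (u (Suc k)) (v (Suc k))"
    and uv: "(\<forall>k. v k = 0) \<or> (\<forall>k. u k = 0) \<and> d\<^sup>2 = 1"
    and m: "m < n" and L: "distinct L" "set L = {..m}"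
  defines "P \<equiv> mat_prod n X L"
  shows "P \<in> carrier_mat n n \<and> trivial_upto n (n - 1 - m) P
    \<and> (frobenius_norm P)\<^sup>2 = real (n - 1) + d\<^sup>2 + (\<Sum>k<m. (u (Suc k))\<^sup>2 + (v (Suc k))\<^sup>2)
    \<and> ((\<forall>k. u k = 0) \<and> d\<^sup>2 = 1 \<longrightarrow>
        row_sq P (n - 1 - m) = 1 \<and> row_sq (transpose_mat P) (n - 1 - m) = 1)"
  using m L unfolding P_def
proof (induction m arbitrary: L)
  case 0
  then have "L = [0]"
    by (cases L) (auto simp: subset_singleton_iff)
  then have P: "mat_prod n X L = end_factor n d"
    using right_mult_one_mat[OF end_factor_carrier] by (simp add: X0)
  have row: "row_sq (end_factor n d) i = (if i = n - 1 then d\<^sup>2 else 1)"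
    and col: "row_sq (transpose_mat (end_factor n d)) i = (if i = n - 1 then d\<^sup>2 else 1)"
    if "i < n" for i
    using that by (auto simp: row_sq_def end_factor_def mat_diag_def if_distrib[of "\<lambda>x. x\<^sup>2"] cong: if_cong)
  obtain n' where n': "n = Suc n'"
    using 0 by (cases n) auto
  have "(frobenius_norm (end_factor n d))\<^sup>2 = (\<Sum>i<n. if i = n - 1 then d\<^sup>2 else 1)"
    unfolding frobenius_norm_sq by (rule sum.cong) (simp add: end_factor_def mat_diag_def, simp only: row lessThan_iff)
  also have "\<dots> = real (n - 1) + d\<^sup>2"
    by (simp add: n')
  finally show ?case
    unfolding P using 0 row[of "n - 1"] col[of "n - 1"]
    by (auto simp: trivial_upto_def end_factor_def mat_diag_def)
next
  case (Suc m)
  \<comment> \<open>Top row of the block of factor \<open>Suc m\<close>; the product of the factors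
    up to \<open>m\<close> is nontrivial only from row \<open>Suc j\<close> on.\<close>
  define j where "j = n - m - 2"
  have j: "Suc j < n" "Suc j = n - 1 - m" "j = n - 1 - Suc m"
    using Suc.prems by (auto simp: j_def)
  let ?E = "block_factor n j (u (Suc m)) (v (Suc m))"
  have E: "X (Suc m) = ?E"
    using XS Suc.prems by (simp add: j_def)
  have c: "X k \<in> carrier_mat n n" if "k \<le> Suc m" for k
    using that Suc.prems X0 XS by (cases k) auto
  have comm: "X (Suc m) * X k = X k * X (Suc m)" if "k < m" for k
  proof (cases k)
    case 0
    then show ?thesis
      unfolding E X0 0 using that j by (intro block_end_factor_commute) auto
  next
    case (Suc k')
    then have "X k = block_factor n (n - k' - 2) (u k) (v k)"
      using that \<open>Suc m < n\<close> XS by simp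
    then show ?thesis
      unfolding E using that \<open>Suc m < n\<close> Suc by (auto intro!: block_factor_commute simp: j_def)
  qed
  obtain K where K: "distinct K" "set K = {..m}"
    "mat_prod n X L = X (Suc m) * mat_prod n X K \<or> mat_prod n X L = mat_prod n X K * X (Suc m)"
    using mat_prod_move_last[where X = X and n = n, OF Suc.prems(2,3) c comm] by blast
  define A where "A = mat_prod n X K"
  define S where "S = (\<Sum>k<m. (u (Suc k))\<^sup>2 + (v (Suc k))\<^sup>2)"
  note IH = Suc.IH[OF Suc_lessD[OF Suc.prems(1)] K(1,2), folded A_def S_def j(2)]
  \<comment> \<open>Both the corner row and the corner column are tracked, since the next factor may
    end up on either side.\<close>
  have A: "A \<in> carrier_mat n n" "trivial_upto n (Suc j) A"
    and nA: "(frobenius_norm A)\<^sup>2 = real (n - 1) + d\<^sup>2 + S"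
    and corner: "(\<forall>k. u k = 0) \<and> d\<^sup>2 = 1 \<Longrightarrow>
        row_sq A (Suc j) = 1 \<and> row_sq (transpose_mat A) (Suc j) = 1"
    using IH by auto
  have AT: "transpose_mat A \<in> carrier_mat n n" "trivial_upto n (Suc j) (transpose_mat A)"
    using A trivial_upto_transpose[OF A(1), of "Suc j"] j(1) by auto
  \<comment> \<open>Either \<open>v\<close> vanishes identically, or the corner row and column have
    norm 1.\<close>
  have v: "(v (Suc m))\<^sup>2 * row_sq A (Suc j) = (v (Suc m))\<^sup>2"
    "(v (Suc m))\<^sup>2 * row_sq (transpose_mat A) (Suc j) = (v (Suc m))\<^sup>2"
    using uv corner by auto
  note st = block_factor_mult_step[OF A(1) j(1) A(2), of "u (Suc m)" "v (Suc m)"]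
    and stT = block_factor_mult_step[OF AT(1) j(1) AT(2), of "u (Suc m)" "v (Suc m)"]
  note EA = mult_carrier_mat[OF block_factor_carrier A(1), of j "u (Suc m)" "v (Suc m)"]
    mult_carrier_mat[OF A(1) block_factor_carrier, of j "u (Suc m)" "v (Suc m)"]
  \<comment> \<open>As \<open>?E\<close> is symmetric, multiplication from the right becomes
    multiplication of the transpose from the left.\<close>
  have tr: "?E * transpose_mat A = transpose_mat (A * ?E)"
    using transpose_mult[OF A(1) block_factor_carrier] by simp
  from K(3)[unfolded E, folded A_def] show ?case
  proof
    assume P: "mat_prod n X L = ?E * A"
    show ?case
      unfolding P j(3)[symmetric] using EA st corner by (auto simp: v nA S_def)
  next
    assume P: "mat_prod n X L = A * ?E"
    have "trivial_upto n j (A * ?E)"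
      using stT(4) trivial_upto_transpose[OF EA(2), of j] j(1) unfolding tr by simp
    then show ?case
      unfolding P j(3)[symmetric] using EA stT[unfolded tr] corner
      by (auto simp: v nA S_def frobenius_norm_transpose)
  qed
qed

section \<open>Inverse and condition number of Fiedler companion matrices\<close>

lemma fiedler_product_inverse:
  assumes n: "0 < n" and c0: "(coeff p 0)\<^sup>2 = 1" and \<sigma>: "\<sigma> permutes {..<n}"
  obtains G where "fiedler_product n p \<sigma> \<in> carrier_mat n n" "G \<in> carrier_mat n n"
    "fiedler_product n p \<sigma> * G = 1\<^sub>m n"
    "(frobenius_norm (fiedler_product n p \<sigma>))\<^sup>2 = real (n - 1) + (\<Sum>k<n. (coeff p k)\<^sup>2)"
    "(frobenius_norm G)\<^sup>2 = real (n - 1) + (\<Sum>k<n. (coeff p k)\<^sup>2)"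
proof -
  define L where "L = map \<sigma> [0..<n]"
  define X where "X = fiedler_factor n p"
  \<comment> \<open>The inverse of the block \<open>[[- c, 1], [1, 0]]\<close> is
    \<open>[[0, 1], [1, c]]\<close>; the end factor is its own inverse because \<open>c0\<close>
    makes its last entry square to 1.\<close>
  define Y where "Y k = (if k = 0 then end_factor n (- coeff p 0)
    else block_factor n (n - k - 1) 0 (coeff p k))" for k
  obtain m where m: "n = Suc m"
    using n by (cases n) auto
  have P: "fiedler_product n p \<sigma> = mat_prod n X L"
    by (simp add: fiedler_product_def mat_prod_def L_def X_def foldr_map o_def)
  have "set L = {..<n}"
    using permutes_image[OF \<sigma>] by (simp add: L_def atLeast0LessThan)
  then have L: "distinct L" "set L = {..m}"
    using permutes_inj_on[OF \<sigma>] m by (auto simp: L_def distinct_map lessThan_Suc_atMost simp del: upt_Suc)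
  have S: "(coeff p 0)\<^sup>2 + (\<Sum>k<m. (coeff p (Suc k))\<^sup>2) = (\<Sum>k<n. (coeff p k)\<^sup>2)"
    unfolding m by (rule sum.lessThan_Suc_shift[symmetric])
  have FX: "mat_prod n X L \<in> carrier_mat n n \<and>
     (frobenius_norm (mat_prod n X L))\<^sup>2 = real (n - 1) + (- coeff p 0)\<^sup>2
        + (\<Sum>k<m. (- coeff p (Suc k))\<^sup>2 + 0\<^sup>2)"
    using factor_product_norm[of X n "- coeff p 0" "\<lambda>k. - coeff p k" "\<lambda>k. 0" m L] L m
    by (simp add: X_def fiedler_factor_0 fiedler_factor_eq_block_factor)
  \<comment> \<open>Here the alternative with \<open>u = 0\<close> and \<open>d\<^sup>2 = 1\<close>
    applies, whereas \<open>FX\<close> used \<open>v = 0\<close>. Reversal keeps the index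
    set.\<close>
  have FY: "mat_prod n Y (rev L) \<in> carrier_mat n n \<and>
     (frobenius_norm (mat_prod n Y (rev L)))\<^sup>2 = real (n - 1) + (- coeff p 0)\<^sup>2
        + (\<Sum>k<m. 0\<^sup>2 + (coeff p (Suc k))\<^sup>2)"
    using factor_product_norm[of Y n "- coeff p 0" "\<lambda>k. 0" "coeff p" m "rev L"] L m c0
    by (simp add: Y_def)
  have "end_factor n (- coeff p 0) * end_factor n (- coeff p 0) = 1\<^sub>m n"
  proof (rule eq_matI)
    fix r s assume "r < dim_row (1\<^sub>m n :: real mat)" "s < dim_col (1\<^sub>m n :: real mat)"
    then show "(end_factor n (- coeff p 0) * end_factor n (- coeff p 0)) $$ (r, s) = 1\<^sub>m n $$ (r, s)"
      using c0 by (simp add: end_factor_mult_entry)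
        (auto simp: end_factor_def mat_diag_def power2_eq_square)
  qed (auto simp: end_factor_def mat_diag_def)
  then have XY: "X k * Y k = 1\<^sub>m n" "X k \<in> carrier_mat n n" "Y k \<in> carrier_mat n n" if "k \<in> set L" for k
    using that L(2) m block_factor_inverse[of "n - k - 1" n "- coeff p k"]
    by (cases "k = 0"; auto simp: X_def Y_def fiedler_factor_0 fiedler_factor_eq_block_factor)+
  show thesis
    using that[of "mat_prod n Y (rev L)"] FX FY S mat_prod_inverse[of L X n Y] XY P by simp
qed

text \<open>The product and its inverse have equal norms, so the condition number is the square of
  that common norm.\<close>

lemma cond_number_fiedler_companion:
  assumes n: "0 < n" and c0: "(coeff p 0)\<^sup>2 = 1" and F: "fiedler_companion n p F"
  shows "cond_number F = real (n - 1) + (\<Sum>k<n. (coeff p k)\<^sup>2)"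
proof -
  obtain \<sigma> where \<sigma>: "\<sigma> permutes {..<n}"
    and F': "F = fiedler_product n p \<sigma> \<or> equivalent_mat n (fiedler_product n p \<sigma>) F"
    using F unfolding fiedler_companion_def by auto
  let ?A = "fiedler_product n p \<sigma>" and ?S = "real (n - 1) + (\<Sum>k<n. (coeff p k)\<^sup>2)"
  obtain G where G: "?A \<in> carrier_mat n n" "G \<in> carrier_mat n n" "?A * G = 1\<^sub>m n"
    and nA: "(frobenius_norm ?A)\<^sup>2 = ?S" and nG: "(frobenius_norm G)\<^sup>2 = ?S"
    using fiedler_product_inverse[OF n c0 \<sigma>] .
  have "frobenius_norm G = frobenius_norm ?A"
    by (rule power2_eq_imp_eq[OF _ frobenius_norm_nonneg frobenius_norm_nonneg]) (simp add: nA nG)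
  then have "cond_number ?A = ?S"
    using cond_number_eq[OF G] nA by (simp add: power2_eq_square)
  then show ?thesis
    using F' cond_number_equivalent_mat[OF G] by auto
qed

subsection \<open>The matrix \<open>M\<close> and its inverse\<close>

text \<open>Found by solving \<open>M x = y\<close> for \<open>a = c_l\<close> and
  \<open>c_0 = 1\<close>: the last row gives \<open>x_0 = - y_(n-1)\<close>, and row
  \<open>i\<close> then gives \<open>x_(i+1)\<close>. Compared with an ordinary companion inverse,
  \<open>c_l\<close> moves from the last column to the first, one row lower.\<close>

definition M_inv :: "nat \<Rightarrow> real poly \<Rightarrow> nat \<Rightarrow> real mat" where
  "M_inv n p l = mat n n (\<lambda>(i, j).
     if i = 0 then (if j = n - 1 then - 1 else 0)
     else if Suc j = i then 1
     else if j = n - 1 then (if i = n - l then 0 else - coeff p (n - i))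
     else if j = 0 \<and> i = n - l + 1 then coeff p l
     else 0)"

text \<open>The first column of \<open>M\<close> for \<open>a = c_l\<close>, with 0-based rows; the
  entry \<open>- c_l + a\<close> has become 0.\<close>

definition M_col :: "nat \<Rightarrow> real poly \<Rightarrow> nat \<Rightarrow> nat \<Rightarrow> real" where
  "M_col n p l i = (if i = n - l - 1 then 0
     else if i = n - l then - coeff p (l - 1) + coeff p l * coeff p (n - 1)
     else - coeff p (n - Suc i))"

text \<open>A sum of indicators makes sums over \<open>k\<close> collapse. The terms never overlap:
  in column 1 the superdiagonal entry lies in row 0, while \<open>n - l\<close> is at least
  2.\<close>

lemma M_mat_entry:
  assumes l: "l \<in> {3..n - 2}" and "i < n" "k < n"
  shows "M_mat n p (coeff p l) l $$ (i, k) =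
    (if k = 0 then M_col n p l i else 0) + (if k = Suc i then 1 else 0)
    + (if k = 1 then (if i = n - l then - coeff p l else 0) else 0)"
proof -
  have "i + 1 = n - l \<longleftrightarrow> i = n - l - 1" "i + 1 = n - l + 1 \<longleftrightarrow> i = n - l" "n - l \<noteq> 0"
    using l by auto
  then show ?thesis
    using assms by (auto simp: M_mat_def Let_def M_col_def)
qed

lemma M_mat_mult_M_inv:
  assumes l: "l \<in> {3..n - 2}" and c0: "coeff p 0 = 1"
  shows "M_mat n p (coeff p l) l * M_inv n p l = 1\<^sub>m n"
proof (rule eq_matI)
  let ?M = "M_mat n p (coeff p l) l" and ?N = "M_inv n p l"
  fix i j assume "i < dim_row (1\<^sub>m n :: real mat)" "j < dim_col (1\<^sub>m n :: real mat)"
  then have ij: "i < n" "j < n" by auto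
  have "(?M * ?N) $$ (i, j) = (\<Sum>k<n. ?M $$ (i, k) * ?N $$ (k, j))"
    by (rule mult_mat_entry) (use ij in \<open>auto simp: M_mat_def M_inv_def\<close>)
  also have "\<dots> = (\<Sum>k<n. (if k = 0 then M_col n p l i * ?N $$ (k, j) else 0)
      + (if k = Suc i then ?N $$ (k, j) else 0)
      + (if k = 1 then (if i = n - l then - coeff p l else 0) * ?N $$ (k, j) else 0))"
    using ij by (intro sum.cong refl) (auto simp: M_mat_entry[OF l] algebra_simps)
  also have "\<dots> = M_col n p l i * ?N $$ (0, j) + (if Suc i < n then ?N $$ (Suc i, j) else 0)
      + (if i = n - l then - coeff p l else 0) * ?N $$ (1, j)"
  proof -
    have "0 < n" "1 < n" using l by auto
    then show ?thesis by (simp add: sum.distrib)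
  qed
  also have "\<dots> = of_bool (i = j)"
  proof -
    have l': "3 \<le> l" "l + 2 \<le> n" using l by auto
    \<comment> \<open>The first two rows carry the modified first-column entries; the last row has
      no superdiagonal entry and is where \<open>c0\<close> enters.\<close>
    consider "i = n - l - 1" | "i = n - l" | "i = n - 1" | "i \<noteq> n - l - 1" "i \<noteq> n - l" "Suc i < n"
      using ij by linarith
    then show ?thesis
    proof cases
      case 1
      then show ?thesis using ij l' by (auto simp: M_inv_def M_col_def)
    next
      case 2
      \<comment> \<open>In the last column the term \<open>c_l * c_(n-1)\<close> of
        \<open>M_col\<close> cancels against \<open>- c_l\<close> times row 1 of the inverse; in
        column 0 the two terms \<open>c_l\<close> cancel.\<close>
      then have "n - Suc i = l - 1" using l' by auto
      then show ?thesis using ij l' 2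
        by (auto simp: M_inv_def M_col_def algebra_simps)
    next
      case 3
      then show ?thesis using ij l' c0 by (auto simp: M_inv_def M_col_def)
    next
      case 4
      then show ?thesis using ij l' by (auto simp: M_inv_def M_col_def)
    qed
  qed
  finally show "(?M * ?N) $$ (i, j) = 1\<^sub>m n $$ (i, j)"
    using ij by simp
qed (simp_all add: M_mat_def M_inv_def)

text \<open>The \<open>c_l\<close> lost from the first column returns in the entry
  \<open>- c_l\<close> of the second. The only net change replaces \<open>c_(l-1)\<close> by
  \<open>c_(l-1) - c_l * c_(n-1)\<close>.\<close>

lemma frobenius_norm_M_mat:
  assumes l: "l \<in> {3..n - 2}"
  shows "(frobenius_norm (M_mat n p (coeff p l) l))\<^sup>2 = real (n - 1) + (\<Sum>k<n. (coeff p k)\<^sup>2)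
    + (coeff p l * coeff p (n - 1))\<^sup>2 - 2 * coeff p (l - 1) * coeff p l * coeff p (n - 1)"
proof -
  let ?M = "M_mat n p (coeff p l) l"
  have l': "3 \<le> l" "l + 2 \<le> n" using l by auto
  have row: "row_sq ?M i = (M_col n p l i)\<^sup>2 + (if i = n - 1 then 0 else 1)
      + (if i = n - l then (coeff p l)\<^sup>2 else 0)" if i: "i < n" for i
  proof -
    have "row_sq ?M i = (\<Sum>k<n. (?M $$ (i, k))\<^sup>2)"
      by (simp add: row_sq_def M_mat_def)
    also have "\<dots> = (\<Sum>k<n. (if k = 0 then (M_col n p l i)\<^sup>2 else 0) + (if k = Suc i then 1 else 0)
       + (if k = 1 then (if i = n - l then (coeff p l)\<^sup>2 else 0) else 0))"
      using i l' by (intro sum.cong refl) (auto simp: M_mat_entry[OF l])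
    also have "\<dots> = (M_col n p l i)\<^sup>2 + (if i = n - 1 then 0 else 1)
      + (if i = n - l then (coeff p l)\<^sup>2 else 0)"
      using i l' by (auto simp: sum.distrib)
    finally show ?thesis .
  qed
  have col: "(M_col n p l i)\<^sup>2 = (coeff p (n - Suc i))\<^sup>2 + (if i = n - l - 1 then - (coeff p l)\<^sup>2 else 0)
      + (if i = n - l then (- coeff p (l - 1) + coeff p l * coeff p (n - 1))\<^sup>2 - (coeff p (l - 1))\<^sup>2 else 0)"
    if "i < n" for i
  proof -
    have "n - Suc (n - l - 1) = l" "n - Suc (n - l) = l - 1" "n - l - 1 \<noteq> n - l"
      using l' by auto
    then show ?thesis by (auto simp: M_col_def)
  qed
  have "(frobenius_norm ?M)\<^sup>2 = (\<Sum>i<n. (coeff p (n - Suc i))\<^sup>2 + (if i = n - l - 1 then - (coeff p l)\<^sup>2 else 0)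
      + (if i = n - l then (- coeff p (l - 1) + coeff p l * coeff p (n - 1))\<^sup>2 - (coeff p (l - 1))\<^sup>2 else 0)
      + (if i = n - 1 then 0 else 1) + (if i = n - l then (coeff p l)\<^sup>2 else 0))"
    unfolding frobenius_norm_sq
    by (rule sum.cong) (simp add: M_mat_def, simp only: row col lessThan_iff)
  also have "\<dots> = (\<Sum>k<n. (coeff p k)\<^sup>2) - (coeff p l)\<^sup>2
      + ((- coeff p (l - 1) + coeff p l * coeff p (n - 1))\<^sup>2 - (coeff p (l - 1))\<^sup>2)
      + (\<Sum>i<n. if i = n - 1 then 0 else 1) + (coeff p l)\<^sup>2"
    using l' by (simp add: sum.distrib sum.nat_diff_reindex[of "\<lambda>k. (coeff p k)\<^sup>2"])
  also have "(\<Sum>i<n. if i = n - 1 then 0 else 1 :: real) = real (n - 1)"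
    using l' by (cases n) auto
  finally show ?thesis
    by (simp add: power2_eq_square algebra_simps)
qed

text \<open>Moving \<open>c_l\<close> to another position does not affect the sum of
  squares.\<close>

lemma frobenius_norm_M_inv:
  assumes l: "l \<in> {3..n - 2}" and c0: "coeff p 0 = 1"
  shows "(frobenius_norm (M_inv n p l))\<^sup>2 = real (n - 1) + (\<Sum>k<n. (coeff p k)\<^sup>2)"
proof -
  have l': "3 \<le> l" "l + 2 \<le> n" using l by auto
  obtain m where m: "n = Suc m" using l' by (cases n) auto
  \<comment> \<open>Squares of the last column before \<open>c_l\<close> is moved; the value 1 at
    row 0 accounts for \<open>c_0\<close>.\<close>
  define g where "g i = (if i = 0 then 1 else (coeff p (n - i))\<^sup>2)" for i
  have row: "row_sq (M_inv n p l) i = g i + (if i = 0 then 0 else 1)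
      + (if i = n - l then - (coeff p l)\<^sup>2 else 0) + (if i = n - l + 1 then (coeff p l)\<^sup>2 else 0)"
    if i: "i < n" for i
  proof -
    \<comment> \<open>At \<open>i = 0\<close> the index \<open>i - 1\<close> truncates to 0, so the
      inner conditional suppresses the term.\<close>
    have "row_sq (M_inv n p l) i = (\<Sum>j<n. (if j = i - 1 then (if i = 0 then 0 else 1) else 0)
      + (if j = n - 1 then (if i = n - l then 0 else g i) else 0)
      + (if j = 0 then (if i = n - l + 1 then (coeff p l)\<^sup>2 else 0) else 0))"
      unfolding row_sq_def using i l'
      by (intro sum.cong) (auto simp: M_inv_def g_def)
    also have "\<dots> = (if i = 0 then 0 else 1) + (if i = n - l then 0 else g i)
      + (if i = n - l + 1 then (coeff p l)\<^sup>2 else 0)"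
      using i l' by (simp add: sum.distrib less_imp_diff_less)
    finally show ?thesis
      using l' by (auto simp: g_def)
  qed
  have "(\<Sum>i<n. g i) = 1 + (\<Sum>i<m. (coeff p (Suc (m - Suc i)))\<^sup>2)"
    unfolding m sum.lessThan_Suc_shift by (simp add: g_def m Suc_diff_Suc)
  also have "\<dots> = 1 + (\<Sum>k<m. (coeff p (Suc k))\<^sup>2)"
    by (simp add: sum.nat_diff_reindex[of "\<lambda>k. (coeff p (Suc k))\<^sup>2"])
  also have "\<dots> = (\<Sum>k<n. (coeff p k)\<^sup>2)"
    unfolding m sum.lessThan_Suc_shift by (simp add: c0)
  finally have g: "(\<Sum>i<n. g i) = (\<Sum>k<n. (coeff p k)\<^sup>2)" .
  have one: "(\<Sum>i<n. if i = 0 then 0 else 1 :: real) = real (n - 1)"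
    unfolding m sum.lessThan_Suc_shift by simp
  have "(frobenius_norm (M_inv n p l))\<^sup>2 = (\<Sum>i<n. g i + (if i = 0 then 0 else 1)
      + (if i = n - l then - (coeff p l)\<^sup>2 else 0) + (if i = n - l + 1 then (coeff p l)\<^sup>2 else 0))"
    unfolding frobenius_norm_sq by (rule sum.cong) (simp add: M_inv_def, simp only: row lessThan_iff)
  also have "\<dots> = real (n - 1) + (\<Sum>k<n. (coeff p k)\<^sup>2)"
    unfolding sum.distrib g one using l' by simp
  finally show ?thesis .
qed

theorem theorem5p4:
  fixes n l :: nat and p :: "real poly" and F :: "real mat"
  assumes "n \<ge> 2"
    and "l \<in> {3..n - 2}"
    and "degree p = n" and "lead_coeff p = 1"
    and "coeff p 0 = 1"
    and "(coeff p l * coeff p (n - 1))\<^sup>2 < 2 * coeff p (l - 1) * coeff p l * coeff p (n - 1) - 1"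
    and "fiedler_companion n p F"
  shows "cond_number (M_mat n p (coeff p l) l) < cond_number F"
proof -
  let ?M = "M_mat n p (coeff p l) l" and ?N = "M_inv n p l"
  \<comment> \<open>The coefficient inequality makes the extra terms in the squared norm of
    \<open>?M\<close> negative.\<close>
  have "(frobenius_norm ?M)\<^sup>2 < (frobenius_norm ?N)\<^sup>2"
    using assms(6) frobenius_norm_M_mat[OF assms(2)] frobenius_norm_M_inv[OF assms(2,5)] by simp
  then have lt: "frobenius_norm ?M < frobenius_norm ?N"
    by (rule power2_less_imp_less[OF _ frobenius_norm_nonneg])
  have "cond_number ?M = frobenius_norm ?M * frobenius_norm ?N"
    by (rule cond_number_eq[OF _ _ M_mat_mult_M_inv[OF assms(2,5)]])
      (simp_all add: M_mat_def M_inv_def)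
  also have "\<dots> < frobenius_norm ?N * frobenius_norm ?N"
    using lt frobenius_norm_nonneg[of ?M] by (intro mult_strict_right_mono) auto
  \<comment> \<open>The squared norm of \<open>?N\<close> is exactly the common condition number of
    all Fiedler companion matrices.\<close>
  also have "\<dots> = cond_number F"
    using cond_number_fiedler_companion[of n p F] frobenius_norm_M_inv[OF assms(2,5)] assms(1,5,7)
    by (simp add: power2_eq_square)
  finally show ?thesis .
qed

end
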